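(* Fix an integer $n \geqslant 3$ and let $R$ be a unital commutative ring for which there exists an $n$-element subset $S \subseteq R$ such that: (1) $S$ is simultaneously a weak multiplicative $B_h$-set for all $1 \leqslant h \leqslant n$; and (2) for all integers $1 < h < n$ and all $h$-element subsets $J \neq J'$ of $S$, the difference $\prod_{s \in J} s - \prod_{s' \in J'} s'$ is a non-zerodivisor in $R$. Let $e_1, \dots, e_n$ be a basis of $R^n$ and set $N := \binom{n}{\lceil n/2 \rceil}$. Then: (i) There exist $N$ directions (vectors) $\mathbf{v}_1, \dots, \mathbf{v}_N \in R^n$ such that for any map $f : R^n \to R$, if the restrictions of $f$ to the lines \[ m_0 + R e_i \ \ (\text{for all } m_0 \in R^n,\ 1 \leqslant i \leqslant n), \qquad \text{and} \qquad R \mathbf{v}_1, \dots, R \mathbf{v}_N \] are each affine-linear, then $f$ is affine-linear on $R^n$. (ii) Fewer than $N$ directions do not suffice: for any integer $0 \leqslant N' < N$ and any vectors $\mathbf{v}_1, \dots, \mathbf{v}_{N'} \in R^n$, there exists a map $f : R^n \to R$ that is not affine-linear on $R^n$, but whose restrictions to all lines $m_0 + R e_i$ ($m_0 \in R^n$, $1 \leqslant i \leqslant n$) and to the lines $R\mathbf{v}_1, \dots, R\mathbf{v}_{N'}$ are each affine-linear.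
   Context: Given an integer $h \geqslant 1$, a finite subset $S$ of a unital commutative ring $R$ is a weak multiplicative $B_h$-set if the product map $\Pi : \binom{S}{h} \to R$, sending each $h$-element subset of $S$ to the product of its elements, is injective; here $\binom{S}{h}$ denotes the set of all $h$-element subsets of $S$. Let $R$ be a unital commutative ring, $N_0 \leqslant M$ two $R$-modules, and $m_0 \in M$. An $R$-valued function $f$ on the affine submodule $\ell := m_0 + N_0 \subseteq M$ is called affine-linear if for all $m_1 \in \ell$, the map $f_{m_1} : N_0 \to R$, $x \mapsto f(x + m_1) - f(m_1)$, is $R$-linear. (The case $N_0 = Re$ gives affine-linearity along the line $m_0 + Re$; the case $N_0 = M$ gives affine-linearity on $M$.) For $e \in M$, $Re = \{re : r \in R\}$. *)

theory Defs
  imports "HOL-Analysis.Analysis"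
begin

definition weak_mult_B_set :: "nat \<Rightarrow> 'a::comm_ring_1 set \<Rightarrow> bool" where
  "weak_mult_B_set h S \<longleftrightarrow>
     finite S \<and> inj_on (\<lambda>J. \<Prod>s\<in>J. s) {J. J \<subseteq> S \<and> card J = h}"

definition non_zerodivisor :: "'a::comm_ring_1 \<Rightarrow> bool" where
  "non_zerodivisor a \<longleftrightarrow> (\<forall>b. a * b = 0 \<longrightarrow> b = 0)"

text \<open>In the following, \<open>act\<close> is the scalar multiplication of an \<open>'a\<close>-module with
  underlying group \<open>'b\<close>, and \<open>N\<close> is meant to be a submodule.  Functions on \<open>N\<close> or on the
  affine submodule \<open>m + N\<close> are represented by total functions; only their values there matter.
  The ring \<open>'a\<close> is a module over itself by multiplication.\<close>

definition linear_form_on ::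
    "('a::comm_ring_1 \<Rightarrow> 'b::ab_group_add \<Rightarrow> 'b) \<Rightarrow> 'b set \<Rightarrow> ('b \<Rightarrow> 'a) \<Rightarrow> bool" where
  "linear_form_on act N g \<longleftrightarrow>
     (\<forall>x\<in>N. \<forall>y\<in>N. g (x + y) = g x + g y) \<and> (\<forall>r. \<forall>x\<in>N. g (act r x) = r * g x)"

definition affine_linear_on ::
    "('a::comm_ring_1 \<Rightarrow> 'b::ab_group_add \<Rightarrow> 'b) \<Rightarrow> 'b \<Rightarrow> 'b set \<Rightarrow> ('b \<Rightarrow> 'a) \<Rightarrow> bool" where
  "affine_linear_on act m N f \<longleftrightarrow>
     (\<forall>m1 \<in> {m + x | x. x \<in> N}. linear_form_on act N (\<lambda>x. f (x + m1) - f m1))"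

definition cyclic_submodule ::
    "('a::comm_ring_1 \<Rightarrow> 'b::ab_group_add \<Rightarrow> 'b) \<Rightarrow> 'b \<Rightarrow> 'b set" where
  "cyclic_submodule act e = {act r e | r. True}"

text \<open>The library interprets \<open>*s\<close> on \<open>'a ^ 'n\<close> as scalar multiplication only over fields.\<close>

interpretation rvec: module "(*s) :: 'a::comm_ring_1 \<Rightarrow> 'a ^ 'n \<Rightarrow> 'a ^ 'n"
  by unfold_locales (vector algebra_simps)+

definition is_basis :: "('n \<Rightarrow> 'a::comm_ring_1 ^ 'n) \<Rightarrow> bool" where
  "is_basis e \<longleftrightarrow> inj e \<and> rvec.independent (range e) \<and> rvec.span (range e) = UNIV"

abbreviation affine_linear_line :: "'a::comm_ring_1 ^ 'n \<Rightarrow> 'a ^ 'n \<Rightarrow> ('a ^ 'n \<Rightarrow> 'a) \<Rightarrow> bool" where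
  "affine_linear_line m e f \<equiv> affine_linear_on (*s) m (cyclic_submodule (*s) e) f"

end

theory Submission
  imports Defs
begin

text \<open>In coordinates with respect to the basis \<open>e\<close>, the functions that are affine-linear along
  all lines parallel to the axes are the square-free polynomials
  \<open>\<Sum>J. a J * (\<Prod>i\<in>J. x i)\<close>.  The elements of \<open>S\<close> together with \<open>0\<close> have pairwise differences
  that are non-zerodivisors, so a polynomial function of degree at most \<open>n\<close> in one variable
  determines its coefficients; hence such a function is affine-linear on a line through \<open>0\<close>
  iff each of its homogeneous parts of degree at least \<open>2\<close> vanishes at the direction vector.
  For the directions \<open>(s\<^sub>1 ^ k, \<dots>, s\<^sub>n ^ k)\<close> with \<open>k < N\<close>, the resulting equations for the
  coefficients of degree \<open>h\<close> form a Vandermonde system in the \<open>h\<close>-fold products, which forces these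
  coefficients to vanish.  Conversely, \<open>N' < N\<close> directions impose \<open>N'\<close> linear equations on the
  \<open>N\<close> coefficients of degree \<open>\<lceil>n / 2\<rceil>\<close>, and such a system has a nonzero solution over any nonzero
  commutative ring.\<close>

section \<open>Non-zerodivisors and Vandermonde systems\<close>

lemma non_zerodivisorD: "non_zerodivisor a \<Longrightarrow> a * b = 0 \<Longrightarrow> b = 0"
  by (simp add: non_zerodivisor_def)

lemma non_zerodivisor_1: "non_zerodivisor 1"
  by (simp add: non_zerodivisor_def)

lemma non_zerodivisor_uminus: "non_zerodivisor (- a) \<longleftrightarrow> non_zerodivisor a"
  by (simp add: non_zerodivisor_def)

text \<open>The forward direction later extracts both \<open>s\<close> and \<open>t - t'\<close>
  from a regular difference of two-fold products.\<close>

lemma non_zerodivisor_mult_iff: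
  "non_zerodivisor (a * b) \<longleftrightarrow> non_zerodivisor a \<and> non_zerodivisor b"
proof
  assume ab: "non_zerodivisor (a * b)"
  have "x = 0" if "a * x = 0 \<or> b * x = 0" for x
  proof (rule non_zerodivisorD[OF ab])
    from that show "a * b * x = 0"
    proof
      assume "a * x = 0"
      then have "b * (a * x) = 0" by simp
      then show ?thesis by (simp only: mult_ac)
    next
      assume "b * x = 0"
      then show ?thesis by (simp add: mult.assoc)
    qed
  qed
  then show "non_zerodivisor a \<and> non_zerodivisor b" unfolding non_zerodivisor_def by blast
next
  assume "non_zerodivisor a \<and> non_zerodivisor b"
  then show "non_zerodivisor (a * b)"
    unfolding non_zerodivisor_def mult.assoc by blast
qed

lemma non_zerodivisor_prod:
  "(\<And>i. i \<in> I \<Longrightarrow> non_zerodivisor (g i)) \<Longrightarrow> non_zerodivisor (\<Prod>i\<in>I. g i)"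
proof (induction I rule: infinite_finite_induct)
  case (insert i I)
  then show ?case by (simp add: non_zerodivisor_mult_iff)
qed (simp_all add: non_zerodivisor_1)

text \<open>The root count over a field survives: after splitting off the factor of one root
  \<open>a\<close>, every other root \<open>x\<close> passes to the quotient because
  \<open>x - a\<close> can be cancelled.\<close>

lemma poly_eq_0_if_roots:
  fixes p :: "'a::comm_ring_1 poly"
  assumes "finite A"
    and "\<And>x y. x \<in> A \<Longrightarrow> y \<in> A \<Longrightarrow> x \<noteq> y \<Longrightarrow> non_zerodivisor (x - y)"
    and "\<And>x. x \<in> A \<Longrightarrow> poly p x = 0"
    and "degree p < card A"
  shows "p = 0"
  using assms
proof (induction A arbitrary: p rule: finite_induct)
  case empty
  then show ?case by simp
next
  case (insert a A)
  have p: "p = [:-a, 1:] * synthetic_div p a"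
    using synthetic_div_correct'[of a p] insert.prems(2)[of a] by simp
  show ?case
  proof (cases "degree p = 0")
    case True
    then show ?thesis
      using insert.prems(2)[of a] by (auto elim!: degree_eq_zeroE)
  next
    case False
    have "poly (synthetic_div p a) x = 0" if "x \<in> A" for x
    proof (rule non_zerodivisorD)
      show "non_zerodivisor (x - a)" using insert.prems(1) insert.hyps that by auto
      have "poly p x = (x - a) * poly (synthetic_div p a) x"
        by (subst p) (simp add: algebra_simps)
      then show "(x - a) * poly (synthetic_div p a) x = 0"
        using insert.prems(2) that by simp
    qed
    moreover have "degree (synthetic_div p a) < card A"
      using False insert.prems(3) insert.hyps by (simp add: degree_synthetic_div)
    ultimately have "synthetic_div p a = 0"
      using insert.IH insert.prems(1) by blast
    then show ?thesis using p by simp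
  qed
qed

text \<open>Combining the equations with the coefficients of a polynomial that vanishes at every
  \<open>y j\<close> except \<open>y i\<close> isolates \<open>a i\<close>, up to a product of
  differences that can be cancelled. The degree below \<open>card I\<close> ensures that only
  available equations enter.\<close>

lemma vandermonde_system_trivial:
  fixes a y :: "'i \<Rightarrow> 'a::comm_ring_1"
  assumes fin: "finite I"
    and nzd: "\<And>i j. i \<in> I \<Longrightarrow> j \<in> I \<Longrightarrow> i \<noteq> j \<Longrightarrow> non_zerodivisor (y i - y j)"
    and eqs: "\<And>k. k < card I \<Longrightarrow> (\<Sum>i\<in>I. a i * y i ^ k) = 0"
    and i: "i \<in> I"
  shows "a i = 0"
proof -
  define p where "p = (\<Prod>j\<in>I - {i}. [:- y j, 1:])"
  have "degree p \<le> (\<Sum>j\<in>I - {i}. degree [:- y j, 1:])"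
    unfolding p_def using fin degree_prod_sum_le[of "I - {i}" "\<lambda>j. [:- y j, 1:]"]
    by (simp add: o_def)
  also have "\<dots> = card I - 1" using fin i by simp
  finally have deg: "degree p < card I" using fin i card_gt_0_iff[of I] by fastforce
  have "(\<Sum>j\<in>I. a j * poly p (y j)) = (\<Sum>j\<in>I. \<Sum>k\<le>degree p. coeff p k * (a j * y j ^ k))"
    by (simp add: poly_altdef sum_distrib_left mult_ac)
  also have "\<dots> = (\<Sum>k\<le>degree p. coeff p k * (\<Sum>j\<in>I. a j * y j ^ k))"
    by (subst sum.swap) (simp add: sum_distrib_left)
  also have "\<dots> = 0" using deg eqs by (intro sum.neutral) auto
  finally have "(\<Sum>j\<in>I. a j * poly p (y j)) = 0" .
  moreover have "poly p (y j) = 0" if "j \<in> I - {i}" for j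
    using fin that unfolding p_def poly_prod by (intro prod_zero) auto
  then have "(\<Sum>j\<in>I. a j * poly p (y j)) = a i * poly p (y i)"
    using fin i by (simp add: sum.remove[of I i])
  ultimately have "poly p (y i) * a i = 0" by (simp add: mult.commute)
  moreover have "non_zerodivisor (poly p (y i))"
    unfolding p_def poly_prod using nzd i by (intro non_zerodivisor_prod) auto
  ultimately show ?thesis by (rule non_zerodivisorD[rotated])
qed

section \<open>Underdetermined linear systems over commutative rings\<close>

text \<open>The solution is sought in an arbitrary nonzero ideal \<open>I\<close>.  A coefficient of the first equation
  that is injective on \<open>I\<close> can be eliminated without division; otherwise \<open>I\<close> can be shrunk to a
  nonzero ideal that is annihilated by all the coefficients of this equation.\<close>

definition nonzero_ideal :: "'a::comm_ring_1 set \<Rightarrow> bool" where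
  "nonzero_ideal I \<longleftrightarrow> 0 \<in> I \<and> (\<forall>x\<in>I. \<forall>y\<in>I. x + y \<in> I) \<and> (\<forall>r. \<forall>x\<in>I. r * x \<in> I) \<and> I \<noteq> {0}"

lemma nonzero_ideal_sum:
  "nonzero_ideal I \<Longrightarrow> (\<And>i. i \<in> A \<Longrightarrow> g i \<in> I) \<Longrightarrow> (\<Sum>i\<in>A. g i) \<in> I"
  by (induction A rule: infinite_finite_induct) (auto simp: nonzero_ideal_def)

lemma exists_regular_or_annihilated:
  assumes "finite U" "nonzero_ideal I"
  shows "(\<exists>J\<subseteq>I. nonzero_ideal J \<and> (\<exists>u\<in>U. \<forall>x\<in>J. b u * x = 0 \<longrightarrow> x = 0)) \<or>
         (\<exists>J\<subseteq>I. nonzero_ideal J \<and> (\<forall>u\<in>U. \<forall>x\<in>J. b u * x = 0))"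
  using assms
proof (induction U rule: finite_induct)
  case empty
  then show ?case by blast
next
  case (insert u U)
  consider (regular) "\<exists>J\<subseteq>I. nonzero_ideal J \<and> (\<exists>u\<in>U. \<forall>x\<in>J. b u * x = 0 \<longrightarrow> x = 0)"
    | (annihilated) J where "J \<subseteq> I" "nonzero_ideal J" "\<forall>u\<in>U. \<forall>x\<in>J. b u * x = 0"
    using insert by blast
  then show ?case
  proof cases
    case regular
    then show ?thesis by blast
  next
    case annihilated
    show ?thesis
    proof (cases "\<forall>x\<in>J. b u * x = 0 \<longrightarrow> x = 0")
      case True
      then show ?thesis using annihilated by blast
    next
      case False
      \<comment> \<open>The annihilator of \<open>b u\<close> in \<open>J\<close> is nonzero because
        injectivity fails, and as a subset of \<open>J\<close> it is still annihilated by the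
        earlier coefficients.\<close>
      define K where "K = {x \<in> J. b u * x = 0}"
      have "nonzero_ideal K"
        using annihilated(2) False
        by (auto simp: nonzero_ideal_def K_def distrib_left mult.left_commute)
      moreover have "K \<subseteq> I" "\<forall>w\<in>insert u U. \<forall>x\<in>K. b w * x = 0"
        using annihilated unfolding K_def by auto
      ultimately show ?thesis by blast
    qed
  qed
qed

text \<open>Induction on the equations. The ideal must be arbitrary, since treating one equation may
  shrink the ideal in which the others are to be solved.\<close>

lemma underdetermined_system_in_ideal:
  fixes A :: "'e \<Rightarrow> 'u \<Rightarrow> 'a::comm_ring_1"
  assumes "finite E" "finite U" "card E < card U" "nonzero_ideal I"
  shows "\<exists>x. (\<forall>u\<in>U. x u \<in> I) \<and> (\<exists>u\<in>U. x u \<noteq> 0) \<and> (\<forall>i\<in>E. (\<Sum>u\<in>U. A i u * x u) = 0)"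
  using assms
proof (induction E arbitrary: A U I rule: finite_induct)
  case empty
  then obtain u where "u \<in> U" by fastforce
  moreover obtain c where "c \<in> I" "c \<noteq> 0" using empty by (auto simp: nonzero_ideal_def)
  ultimately show ?case by (intro exI[of _ "\<lambda>_. c"]) auto
next
  case (insert e E)
  from exists_regular_or_annihilated[OF insert.prems(1,3), of "A e"] show ?case
  proof (elim disjE exE conjE bexE)
    fix J
    assume annihilated: "J \<subseteq> I" "nonzero_ideal J" "\<forall>u\<in>U. \<forall>x\<in>J. A e u * x = 0"
    have "card E < card U" using insert by simp
    from insert.IH[OF insert.prems(1) this annihilated(2), of A] obtain x where
      "\<forall>u\<in>U. x u \<in> J" "\<exists>u\<in>U. x u \<noteq> 0" "\<forall>i\<in>E. (\<Sum>u\<in>U. A i u * x u) = 0" by blast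
    moreover from this have "(\<Sum>u\<in>U. A e u * x u) = 0"
      using annihilated(3) by (intro sum.neutral) auto
    ultimately show ?thesis using annihilated(1) by (intro exI[of _ x]) auto
  next
    fix J u
    assume regular: "J \<subseteq> I" "nonzero_ideal J" "u \<in> U" "\<forall>x\<in>J. A e u * x = 0 \<longrightarrow> x = 0"
    define V where "V = U - {u}"
    have V: "finite V" "card E < card V" "u \<notin> V" "U = insert u V"
      using insert regular(3) by (auto simp: V_def)
    \<comment> \<open>Unknown \<open>u\<close> is eliminated by cross-multiplication:
      \<open>A e u\<close> times equation \<open>i\<close> minus \<open>A i u\<close> times equation
      \<open>e\<close>.\<close>
    from insert.IH[OF V(1,2) regular(2), of "\<lambda>i w. A e u * A i w - A i u * A e w"] obtain z where
      z: "\<forall>w\<in>V. z w \<in> J" "\<exists>w\<in>V. z w \<noteq> 0"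
        "\<forall>i\<in>E. (\<Sum>w\<in>V. (A e u * A i w - A i u * A e w) * z w) = 0" by blast
    \<comment> \<open>Scaling \<open>z\<close> by \<open>A e u\<close> allows equation
      \<open>e\<close> to be solved for \<open>x u\<close> without division.\<close>
    define x where "x w = (if w = u then - (\<Sum>w\<in>V. A e w * z w) else A e u * z w)" for w
    have sum_x: "(\<Sum>w\<in>U. A i w * x w) = (\<Sum>w\<in>V. (A e u * A i w - A i u * A e w) * z w)" for i
    proof -
      have "(\<Sum>w\<in>V. A i w * x w) = (\<Sum>w\<in>V. A e u * A i w * z w)"
        using V(3) by (intro sum.cong) (auto simp: x_def mult_ac)
      then show ?thesis
        using V by (simp add: x_def sum_subtractf sum_distrib_left left_diff_distrib mult.assoc)
    qed
    have sum_e: "(\<Sum>w\<in>U. A e w * x w) = 0" by (simp add: sum_x)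
    have "(\<Sum>w\<in>V. A e w * z w) \<in> J"
      using regular(2) z(1) by (intro nonzero_ideal_sum) (auto simp: nonzero_ideal_def)
    then have "- 1 * (\<Sum>w\<in>V. A e w * z w) \<in> J"
      using regular(2) unfolding nonzero_ideal_def by blast
    then have "\<forall>w\<in>U. x w \<in> J"
      using regular(2) z(1) V(4) by (auto simp: x_def nonzero_ideal_def)
    \<comment> \<open>Scaling loses no nonzero entry: \<open>z w\<close> lies in \<open>J\<close>,
      where multiplication by \<open>A e u\<close> is injective.\<close>
    moreover have "\<exists>w\<in>U. x w \<noteq> 0"
      using z(1,2) regular(4) V(3,4) by (metis insertCI x_def)
    moreover have "\<forall>i\<in>insert e E. (\<Sum>w\<in>U. A i w * x w) = 0"
      using sum_e z(3) sum_x by auto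
    ultimately show ?thesis using regular(1) by blast
  qed
qed

lemma underdetermined_system_nontrivial:
  fixes A :: "'e \<Rightarrow> 'u \<Rightarrow> 'a::comm_ring_1"
  assumes "finite E" "finite U" "card E < card U"
  shows "\<exists>x. (\<exists>u\<in>U. x u \<noteq> 0) \<and> (\<forall>i\<in>E. (\<Sum>u\<in>U. A i u * x u) = 0)"
proof -
  have "(UNIV :: 'a set) \<noteq> {0}" by (metis UNIV_I singletonD zero_neq_one)
  then have "nonzero_ideal (UNIV :: 'a set)" by (simp add: nonzero_ideal_def)
  from underdetermined_system_in_ideal[OF assms this] show ?thesis by blast
qed

section \<open>Affine-linearity in coordinates\<close>

text \<open>Reduces the condition at all base points of the line to interpolation between the values
  at \<open>m\<close> and \<open>m + v\<close>. It is stated in the parameter \<open>r\<close>,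
  which the point \<open>r *s v\<close> need not determine.\<close>

lemma affine_linear_line_iff:
  "affine_linear_line m v f \<longleftrightarrow> (\<forall>r. f (m + r *s v) = f m + r * (f (m + v) - f m))"
proof
  assume "affine_linear_line m v f"
  moreover have "0 *s v \<in> cyclic_submodule (*s) v" "1 *s v \<in> cyclic_submodule (*s) v"
    by (auto simp: cyclic_submodule_def intro: exI[of _ 0] exI[of _ 1])
  ultimately have "f (r *s v + m) - f m = r * (f (v + m) - f m)" for r
    unfolding affine_linear_on_def linear_form_on_def
    by (smt (verit) add_0_right mem_Collect_eq vector_smult_lid vector_smult_lzero)
  then show "\<forall>r. f (m + r *s v) = f m + r * (f (m + v) - f m)"
    by (simp add: add.commute diff_eq_eq)
next
  assume f: "\<forall>r. f (m + r *s v) = f m + r * (f (m + v) - f m)"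
  \<comment> \<open>The increment does not depend on \<open>t\<close>, so one base point controls
    all of them.\<close>
  have line: "f (r *s v + (m + t *s v)) - f (m + t *s v) = r * (f (m + v) - f m)" for r t
  proof -
    have eq: "r *s v + (m + t *s v) = m + (r + t) *s v" by (simp add: vector_sadd_rdistrib)
    show ?thesis
      unfolding eq f[rule_format, of "r + t"] f[rule_format, of t] by (simp add: algebra_simps)
  qed
  show "affine_linear_line m v f"
    unfolding affine_linear_on_def linear_form_on_def cyclic_submodule_def
    by (intro ballI conjI allI; elim CollectE exE conjE; hypsubst)
      (simp_all only: vector_sadd_rdistrib[symmetric] vector_smult_assoc line distrib_right mult.assoc)
qed

text \<open>Induction on the support: \<open>g y\<close> is \<open>g (y(i := 0))\<close> plus
  \<open>y i\<close> times a difference quotient, and both pieces are again multiaffine, evaluated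
  at points supported in the smaller set.\<close>

lemma multiaffine_expansion:
  fixes g :: "('n \<Rightarrow> 'a::comm_ring_1) \<Rightarrow> 'a"
  assumes "finite A"
    and "\<And>y i r. g (y(i := r)) = g (y(i := 0)) + r * (g (y(i := 1)) - g (y(i := 0)))"
  shows "\<exists>a. \<forall>y. (\<forall>i. i \<notin> A \<longrightarrow> y i = 0) \<longrightarrow> g y = (\<Sum>J\<in>Pow A. a J * (\<Prod>i\<in>J. y i))"
  using assms
proof (induction A arbitrary: g rule: finite_induct)
  case empty
  show ?case
  proof (intro exI[of _ "\<lambda>_. g (\<lambda>_. 0)"] allI impI)
    fix y :: "'n \<Rightarrow> 'a"
    assume "\<forall>i. i \<notin> {} \<longrightarrow> y i = 0"
    then have "y = (\<lambda>_. 0)" by auto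
    then show "g y = (\<Sum>J\<in>Pow {}. g (\<lambda>_. 0) * (\<Prod>i\<in>J. y i))" by simp
  qed
next
  case (insert i A)
  obtain a where a: "\<And>y. (\<forall>i. i \<notin> A \<longrightarrow> y i = 0) \<Longrightarrow> g y = (\<Sum>J\<in>Pow A. a J * (\<Prod>i\<in>J. y i))"
    using insert.IH[OF insert.prems] by blast
  \<comment> \<open>The discrete partial derivative in coordinate \<open>i\<close>, which is
    independent of \<open>y i\<close>.\<close>
  define d where "d y = g (y(i := 1)) - g (y(i := 0))" for y
  have "d (y(j := r)) = d (y(j := 0)) + r * (d (y(j := 1)) - d (y(j := 0)))" for y j r
  proof (cases "j = i")
    case True
    then show ?thesis by (simp add: d_def)
  next
    case False
    have d: "d (y(j := t)) = g (y(i := 1, j := t)) - g (y(i := 0, j := t))" for t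
      unfolding d_def fun_upd_twist[OF False] ..
    show ?thesis
      unfolding d insert.prems[of "y(i := 1)" j r] insert.prems[of "y(i := 0)" j r]
      by (simp add: right_diff_distrib)
  qed
  then obtain b where b: "\<And>y. (\<forall>i. i \<notin> A \<longrightarrow> y i = 0) \<Longrightarrow> d y = (\<Sum>J\<in>Pow A. b J * (\<Prod>i\<in>J. y i))"
    using insert.IH[of d] by blast
  \<comment> \<open>Monomials containing \<open>i\<close> take their coefficients from
    \<open>d\<close>, the others from \<open>g\<close> at \<open>y i = 0\<close>.\<close>
  define c where "c J = (if i \<in> J then b (J - {i}) else a J)" for J
  have "g y = (\<Sum>J\<in>Pow (insert i A). c J * (\<Prod>i\<in>J. y i))" if y: "\<forall>j. j \<notin> insert i A \<longrightarrow> y j = 0" for y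
  proof -
    let ?z = "y(i := 0)"
    have z: "\<forall>j. j \<notin> A \<longrightarrow> ?z j = 0" using y by auto
    have prod_z: "(\<Prod>j\<in>J. ?z j) = (\<Prod>j\<in>J. y j)" if "J \<in> Pow A" for J
      using that insert.hyps(2) by (intro prod.cong) auto
    have "g y = g ?z + y i * d ?z"
      using insert.prems[of y i "y i"] unfolding d_def by (simp only: fun_upd_triv fun_upd_upd)
    also have "g ?z = (\<Sum>J\<in>Pow A. c J * (\<Prod>i\<in>J. y i))"
      unfolding a[OF z] using prod_z insert.hyps(2) by (intro sum.cong) (auto simp: c_def)
    also have "y i * d ?z = (\<Sum>J\<in>insert i ` Pow A. c J * (\<Prod>i\<in>J. y i))"
    proof -
      have "inj_on (insert i) (Pow A)" using insert.hyps(2) by (auto simp: inj_on_def)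
      moreover have "y i * (b J * (\<Prod>j\<in>J. ?z j)) = c (insert i J) * (\<Prod>j\<in>insert i J. y j)"
        if "J \<in> Pow A" for J
      proof -
        have "finite J" "i \<notin> J" using that insert.hyps finite_subset by auto
        then show ?thesis unfolding prod_z[OF that] by (simp add: c_def mult_ac)
      qed
      ultimately show ?thesis unfolding b[OF z] by (simp add: sum_distrib_left sum.reindex)
    qed
    also have "(\<Sum>J\<in>Pow A. c J * (\<Prod>i\<in>J. y i)) + (\<Sum>J\<in>insert i ` Pow A. c J * (\<Prod>i\<in>J. y i)) =
        (\<Sum>J\<in>Pow (insert i A). c J * (\<Prod>i\<in>J. y i))"
      unfolding Pow_insert using insert.hyps by (intro sum.union_disjoint[symmetric]) auto
    finally show ?thesis .
  qed
  then show ?case by blast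
qed

section \<open>Coordinates with respect to a basis, and square-free polynomials in them\<close>

context
  fixes e :: "'n::finite \<Rightarrow> 'a::comm_ring_1 ^ 'n"
  assumes basis: "is_basis e"
begin

definition coord :: "'n \<Rightarrow> 'a ^ 'n \<Rightarrow> 'a" where
  "coord i x = rvec.representation (range e) x (e i)"

lemma coord_add: "coord i (x + y) = coord i x + coord i y"
  and coord_scale: "coord i (r *s x) = r * coord i x"
  and coord_basis: "coord i (e j) = (if i = j then 1 else 0)"
  using basis unfolding is_basis_def coord_def inj_def
  by (auto simp: rvec.representation_add rvec.representation_scale rvec.representation_basis)

lemma coord_expansion: "(\<Sum>i\<in>UNIV. coord i x *s e i) = x"
proof -
  have "(\<Sum>b\<in>range e. rvec.representation (range e) x b *s b) = x"
    using basis unfolding is_basis_def by (intro rvec.sum_representation_eq) auto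
  then show ?thesis using basis by (simp add: is_basis_def sum.reindex coord_def)
qed

lemma coord_0: "coord i 0 = 0"
  using coord_scale[of i 0 0] by simp

lemma coord_sum: "coord i (\<Sum>k\<in>K. g k) = (\<Sum>k\<in>K. coord i (g k))"
  by (induction K rule: infinite_finite_induct) (auto simp: coord_add coord_0)

lemma coord_of_combination: "coord i (\<Sum>j\<in>UNIV. y j *s e j) = y i"
  by (simp add: coord_sum coord_scale coord_basis if_distrib cong: if_cong)

text \<open>Changing coordinate \<open>i\<close> is moving along \<open>e i\<close>, so the
  hypothesis is exactly multiaffinity in coordinates; with full support the expansion holds
  everywhere.\<close>

lemma affine_in_basis_directions_imp_polynomial:
  assumes "\<And>m i. affine_linear_line m (e i) f"
  shows "\<exists>a. \<forall>x. f x = (\<Sum>J\<in>UNIV. a J * (\<Prod>i\<in>J. coord i x))"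
proof -
  define E where "E y = (\<Sum>j\<in>UNIV. y j *s e j)" for y
  have E_upd: "E (y(i := r)) = E (y(i := 0)) + r *s e i" for y i r
  proof -
    have "E (y(i := r)) = (\<Sum>j\<in>UNIV. (y(i := 0)) j *s e j + (if j = i then r *s e i else 0))"
      unfolding E_def by (intro sum.cong) auto
    then show ?thesis by (simp add: E_def sum.distrib)
  qed
  have multiaffine: "f (E (y(i := r))) = f (E (y(i := 0))) + r * (f (E (y(i := 1))) - f (E (y(i := 0))))"
    for y i r
    using assms[of "E (y(i := 0))" i] E_upd[of y i r] E_upd[of y i 1]
    unfolding affine_linear_line_iff by simp
  obtain a where a: "\<And>y. f (E y) = (\<Sum>J\<in>UNIV. a J * (\<Prod>i\<in>J. y i))"
    using multiaffine_expansion[of UNIV "\<lambda>y. f (E y)", OF finite multiaffine] by auto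
  have "f x = (\<Sum>J\<in>UNIV. a J * (\<Prod>i\<in>J. coord i x))" for x
    using a[of "\<lambda>i. coord i x"] by (simp add: E_def coord_expansion)
  then show ?thesis by blast
qed

text \<open>Each monomial contains coordinate \<open>i\<close> at most once, and its other factors
  are constant along \<open>e i\<close>.\<close>

lemma polynomial_affine_in_basis_directions:
  "affine_linear_line m (e i) (\<lambda>x. \<Sum>J\<in>\<J>. a J * (\<Prod>i\<in>J. coord i x))"
proof -
  have "(\<Prod>j\<in>J. coord j (m + r *s e i)) =
      (\<Prod>j\<in>J. coord j m) + r * ((\<Prod>j\<in>J. coord j (m + e i)) - (\<Prod>j\<in>J. coord j m))" for J r
  proof (cases "i \<in> J")
    case True
    have "(\<Prod>j\<in>J - {i}. coord j (m + t *s e i)) = (\<Prod>j\<in>J - {i}. coord j m)" for t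
      by (intro prod.cong) (auto simp: coord_add coord_scale coord_basis)
    from this[of r] this[of 1] True show ?thesis
      by (simp add: prod.remove[of J i] coord_add coord_scale coord_basis algebra_simps)
  next
    case False
    have "(\<Prod>j\<in>J. coord j (m + t *s e i)) = (\<Prod>j\<in>J. coord j m)" for t
      using False by (intro prod.cong) (auto simp: coord_add coord_scale coord_basis)
    from this[of r] this[of 1] show ?thesis by simp
  qed
  then show ?thesis
    unfolding affine_linear_line_iff
    by (simp add: sum_distrib_left flip: sum.distrib sum_subtractf) (simp add: algebra_simps)
qed

section \<open>Restriction to lines through the origin\<close>

lemma polynomial_on_line:
  "(\<Sum>J\<in>\<J>. a J * (\<Prod>i\<in>J. coord i (r *s v))) =
   (\<Sum>J\<in>\<J>. a J * (\<Prod>i\<in>J. coord i v) * r ^ card J)"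
  by (simp add: coord_scale prod.distrib mult_ac)

text \<open>On \<open>r *s v\<close> the degree-\<open>h\<close> part of \<open>f\<close> becomes
  the coefficient of \<open>r ^ h\<close>. The set \<open>A\<close> has enough points to turn
  equality of functions into equality of coefficients.\<close>

lemma homogeneous_part_vanishes:
  fixes A :: "'a set"
  assumes f: "\<And>x. f x = (\<Sum>J\<in>UNIV. a J * (\<Prod>i\<in>J. coord i x))"
    and line: "affine_linear_line 0 v f"
    and "finite A" "CARD('n) < card A"
    and "\<And>x y. x \<in> A \<Longrightarrow> y \<in> A \<Longrightarrow> x \<noteq> y \<Longrightarrow> non_zerodivisor (x - y)"
    and "h \<ge> 2"
  shows "(\<Sum>J | card J = h. a J * (\<Prod>i\<in>J. coord i v)) = 0"
proof -
  define b where "b J = a J * (\<Prod>i\<in>J. coord i v)" for J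
  \<comment> \<open>The restriction minus the affine function with the same values at parameters 0
    and 1.\<close>
  define p where "p = (\<Sum>J\<in>UNIV. monom (b J) (card J)) - [:f 0, f v - f 0:]"
  have "poly p r = f (r *s v) - (f 0 + r * (f v - f 0))" for r
    unfolding f[of "r *s v"] polynomial_on_line
    by (simp add: p_def b_def poly_sum poly_monom)
  then have "poly p r = 0" for r
    using line by (simp add: affine_linear_line_iff)
  moreover have "degree p \<le> CARD('n)"
    unfolding p_def
  proof (intro degree_diff_le degree_sum_le)
    show "degree (monom (b J) (card J)) \<le> CARD('n)" for J
      using degree_monom_le[of "b J" "card J"] card_mono[of UNIV J] by simp
    have "CARD('n) \<ge> 1" by (simp add: Suc_leI)
    then show "degree [:f 0, f v - f 0:] \<le> CARD('n)"
      by (simp)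
  qed auto
  ultimately have "p = 0" using assms(3-5) by (intro poly_eq_0_if_roots[of A]) auto
  then have "coeff (\<Sum>J\<in>UNIV. monom (b J) (card J)) h = coeff [:f 0, f v - f 0:] h"
    by (simp add: p_def)
  moreover have "coeff [:f 0, f v - f 0:] h = 0"
    using \<open>h \<ge> 2\<close> by (intro coeff_eq_0) auto
  moreover have "coeff (\<Sum>J\<in>UNIV. monom (b J) (card J)) h = (\<Sum>J | card J = h. b J)"
    by (simp add: coeff_sum sum.If_cases)
  ultimately show ?thesis by (simp add: b_def)
qed

lemma affine_linear_if_degree_le_1:
  assumes f: "\<And>x. f x = (\<Sum>J\<in>UNIV. a J * (\<Prod>i\<in>J. coord i x))"
    and a: "\<And>J. card J \<ge> 2 \<Longrightarrow> a J = 0"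
  shows "affine_linear_on (*s) 0 UNIV f"
proof -
  have "f x = a {} + (\<Sum>i\<in>UNIV. a {i} * coord i x)" for x
  proof -
    have inj: "inj (\<lambda>i::'n. {i})" by (simp add: inj_def)
    have "a J = 0" if "J \<notin> insert {} (range (\<lambda>i. {i}))" for J
    proof (rule a)
      have "card J \<noteq> 0" "card J \<noteq> 1" using that by (auto simp: card_1_singleton_iff)
      then show "2 \<le> card J" by linarith
    qed
    then have "f x = (\<Sum>J\<in>insert {} (range (\<lambda>i. {i})). a J * (\<Prod>i\<in>J. coord i x))"
      unfolding f by (intro sum.mono_neutral_right) auto
    also have "\<dots> = a {} + (\<Sum>J\<in>range (\<lambda>i. {i}). a J * (\<Prod>i\<in>J. coord i x))"
      by (subst sum.insert) auto
    finally show ?thesis by (simp add: sum.reindex[OF inj] o_def)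
  qed
  then show ?thesis
    by (auto simp: affine_linear_on_def linear_form_on_def coord_add coord_scale
        distrib_left sum.distrib sum_distrib_left mult_ac)
qed

section \<open>Sufficient and insufficient families of directions\<close>

lemma sufficient_directions:
  fixes S :: "'a set"
  assumes S: "finite S" "card S = CARD('n)" "CARD('n) \<ge> 3"
    and nzd: "\<And>h J J'. 1 < h \<Longrightarrow> h < CARD('n) \<Longrightarrow> J \<subseteq> S \<Longrightarrow> card J = h \<Longrightarrow>
      J' \<subseteq> S \<Longrightarrow> card J' = h \<Longrightarrow> J \<noteq> J' \<Longrightarrow> non_zerodivisor (\<Prod>J - \<Prod>J')"
    and N: "\<And>h. CARD('n) choose h \<le> N"
  shows "\<exists>v :: nat \<Rightarrow> 'a ^ 'n. \<forall>f.
    (\<forall>m i. affine_linear_line m (e i) f) \<longrightarrow>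
    (\<forall>j\<in>{1..N}. affine_linear_line 0 (v j) f) \<longrightarrow> affine_linear_on (*s) 0 UNIV f"
proof -
  \<comment> \<open>The case \<open>h = 2\<close>, available because \<open>n\<close> is at least 3,
    for the pairs \<open>{s, t}\<close> and \<open>{s, t'}\<close> with common element
    \<open>s\<close>.\<close>
  have diff_S: "non_zerodivisor (s * (t - t'))"
    if "s \<in> S" "t \<in> S" "t' \<in> S" "s \<noteq> t" "s \<noteq> t'" "t \<noteq> t'" for s t t'
    using nzd[of 2 "{s, t}" "{s, t'}"] that S by (auto simp: right_diff_distrib doubleton_eq_iff)
  have third: "\<exists>s\<in>S. s \<noteq> t \<and> s \<noteq> t'" for t t'
  proof (rule ccontr)
    assume "\<not> ?thesis"
    then have "S \<subseteq> {t, t'}" by blast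
    then have "card S \<le> card {t, t'}" by (intro card_mono) auto
    also have "\<dots> \<le> 2" by (simp add: card_insert_if)
    finally show False using S by simp
  qed
  have diff: "non_zerodivisor (t - t')" if "t \<in> S" "t' \<in> S" "t \<noteq> t'" for t t'
    using third[of t t'] diff_S that by (metis non_zerodivisor_mult_iff)
  have nzd_S: "non_zerodivisor s" if "s \<in> S" for s
    using third[of s s] third[of s] diff_S that by (metis non_zerodivisor_mult_iff)
  have "0 \<notin> S"
  proof
    assume "0 \<in> S"
    then have "non_zerodivisor (0::'a)" by (rule nzd_S)
    then have "(b::'a) = 0" for b by (simp add: non_zerodivisor_def)
    then show False using third[of 0 0] by blast
  qed
  \<comment> \<open>Adding 0 gives \<open>n + 1\<close> points, one more than the degree bound on
    lines; differences with 0 are regular because the elements of \<open>S\<close> are.\<close>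
  define A where "A = insert 0 S"
  have A: "finite A" "CARD('n) < card A"
    "\<And>x y. x \<in> A \<Longrightarrow> y \<in> A \<Longrightarrow> x \<noteq> y \<Longrightarrow> non_zerodivisor (x - y)"
    using S \<open>0 \<notin> S\<close> diff nzd_S by (auto simp: A_def non_zerodivisor_uminus)
  obtain \<sigma> where \<sigma>: "bij_betw \<sigma> (UNIV :: 'n set) S"
    using finite_same_card_bij[of "UNIV :: 'n set" S] S by auto
  then have inj: "inj_on \<sigma> J" and ran: "\<sigma> ` J \<subseteq> S" for J
    by (auto simp: bij_betw_def inj_on_def)
  \<comment> \<open>The shift \<open>j - 1\<close> starts the exponents at 0, so direction
    \<open>Suc k\<close> yields the Vandermonde equation with exponent \<open>k\<close>.\<close>
  define v where "v j = (\<Sum>i\<in>UNIV. \<sigma> i ^ (j - 1) *s e i)" for j :: nat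
  have "affine_linear_on (*s) 0 UNIV f"
    if basis_lines: "\<forall>m i. affine_linear_line m (e i) f"
      and lines: "\<forall>j\<in>{1..N}. affine_linear_line 0 (v j) f" for f
  proof -
    from basis_lines obtain a where a: "\<And>x. f x = (\<Sum>J\<in>UNIV. a J * (\<Prod>i\<in>J. coord i x))"
      using affine_in_basis_directions_imp_polynomial[of f] by blast
    have "a J = 0" if J: "card J \<ge> 2" for J
    proof -
      let ?I = "{K :: 'n set. card K = card J}"
      have "card ?I = CARD('n) choose card J"
        using n_subsets[of "UNIV :: 'n set" "card J"] by simp
      \<comment> \<open>As \<open>N\<close> bounds every binomial coefficient, the same directions
        supply enough equations in each degree.\<close>
      then have card_I: "card ?I \<le> N" using N by simp
      have eqs: "(\<Sum>K\<in>?I. a K * (\<Prod>(\<sigma> ` K)) ^ k) = 0" if "k < card ?I" for k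
      proof -
        have "(\<Sum>K\<in>?I. a K * (\<Prod>i\<in>K. coord i (v (Suc k)))) = 0"
          using lines that card_I by (intro homogeneous_part_vanishes[OF a _ A J]) auto
        then show ?thesis
          by (simp add: v_def coord_of_combination prod.reindex[OF inj] prod_power_distrib)
      qed
      have diff_prod: "non_zerodivisor (\<Prod>(\<sigma> ` K) - \<Prod>(\<sigma> ` L))" if KL: "K \<in> ?I" "L \<in> ?I" "K \<noteq> L" for K L
      proof (rule nzd)
        show "1 < card J" using J by simp
        have "card J \<le> CARD('n)" by (intro card_mono) auto
        \<comment> \<open>The hypothesis \<open>nzd\<close> does not cover degree \<open>n\<close>,
          but there the only index set is \<open>UNIV\<close>, contradicting that \<open>K\<close>
          and \<open>L\<close> differ.\<close>
        moreover have "M = UNIV" if "card M = CARD('n)" for M :: "'n set"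
          using that by (intro card_subset_eq) auto
        from this[of K] this[of L] have "card J \<noteq> CARD('n)" using KL by auto
        ultimately show "card J < CARD('n)" by simp
        show "\<sigma> ` K \<noteq> \<sigma> ` L"
          using KL(3) inj[of UNIV] by (simp add: inj_image_eq_iff)
      qed (use KL inj ran in \<open>auto simp: card_image\<close>)
      show ?thesis
        by (rule vandermonde_system_trivial[where I = ?I and y = "\<lambda>K. \<Prod>(\<sigma> ` K)"])
          (use eqs diff_prod in auto)
    qed
    then show ?thesis by (rule affine_linear_if_degree_le_1[OF a])
  qed
  then show ?thesis by blast
qed

text \<open>A homogeneous square-free polynomial of degree \<open>h\<close> has one coefficient per
  \<open>h\<close>-subset; requiring it to vanish at each \<open>v j\<close> is one linear equation,
  and homogeneity then makes it vanish on the whole line.\<close>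

lemma insufficient_directions:
  fixes v :: "nat \<Rightarrow> 'a ^ 'n"
  assumes h: "h \<ge> 2" and N': "N' < CARD('n) choose h"
  shows "\<exists>f. \<not> affine_linear_on (*s) 0 UNIV f \<and>
    (\<forall>m i. affine_linear_line m (e i) f) \<and> (\<forall>j\<in>{1..N'}. affine_linear_line 0 (v j) f)"
proof -
  let ?I = "{J :: 'n set. card J = h}"
  have "card {1..N'} < card ?I"
    using N' n_subsets[of "UNIV :: 'n set" h] by simp
  from underdetermined_system_nontrivial[OF _ _ this, of "\<lambda>j J. \<Prod>i\<in>J. coord i (v j)"]
  obtain a J where a: "\<forall>j\<in>{1..N'}. (\<Sum>J\<in>?I. (\<Prod>i\<in>J. coord i (v j)) * a J) = 0"
    and J: "J \<in> ?I" "a J \<noteq> 0" by auto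
  define f where "f x = (\<Sum>J\<in>?I. a J * (\<Prod>i\<in>J. coord i x))" for x
  have f_v: "f (r *s v j) = 0" if "j \<in> {1..N'}" for r j
  proof -
    have "f (r *s v j) = r ^ h * (\<Sum>J\<in>?I. (\<Prod>i\<in>J. coord i (v j)) * a J)"
      unfolding f_def polynomial_on_line sum_distrib_left by (intro sum.cong) (auto simp: mult_ac)
    then show ?thesis using a that by simp
  qed
  have "\<forall>j\<in>{1..N'}. affine_linear_line 0 (v j) f"
    using f_v f_v[of _ 0] f_v[of _ 1] by (simp add: affine_linear_line_iff)
  moreover have "\<forall>m i. affine_linear_line m (e i) f"
    unfolding f_def using polynomial_affine_in_basis_directions by blast
  moreover have "\<not> affine_linear_on (*s) 0 UNIV f"
  proof
    have f_0: "f 0 = 0"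
      unfolding f_def using h by (intro sum.neutral) (auto simp: coord_0 power_0_left)
    assume "affine_linear_on (*s) 0 UNIV f"
    then have "\<forall>m. linear_form_on (*s) UNIV (\<lambda>x. f (x + m) - f m)"
      by (simp add: affine_linear_on_def)
    from this[rule_format, of 0] have f_add: "f (x + y) = f x + f y" for x y
      by (simp add: linear_form_on_def f_0)
    have f_e: "f (e i) = 0" for i
      unfolding f_def
    proof (intro sum.neutral ballI)
      fix K assume "K \<in> ?I"
      then have "\<not> K \<subseteq> {i}" using h card_mono[of "{i}" K] by auto
      then have "(\<Prod>j\<in>K. coord j (e i)) = 0"
        by (intro prod_zero) (auto simp: coord_basis)
      then show "a K * (\<Prod>j\<in>K. coord j (e i)) = 0" by simp
    qed
    have f_sum: "f (\<Sum>i\<in>K. e i) = 0" for K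
      by (induction K rule: infinite_finite_induct) (auto simp: f_0 f_add f_e)
    \<comment> \<open>The sum of the \<open>e j\<close> over \<open>J\<close> is the indicator
      vector of \<open>J\<close>. Of the monomials of degree \<open>h\<close> only that of
      \<open>J\<close> survives there, so \<open>f\<close> takes the value \<open>a J\<close>, while
      additivity forces 0.\<close>
    have coord_J: "coord i (\<Sum>j\<in>J. e j) = (if i \<in> J then 1 else 0)" for i
      by (simp add: coord_sum coord_basis)
    have "(\<Prod>i\<in>K. coord i (\<Sum>j\<in>J. e j)) = 0" if "K \<in> ?I - {J}" for K
    proof -
      have "\<not> K \<subseteq> J" using that J card_subset_eq[of J K] by auto
      then show ?thesis by (intro prod_zero) (auto simp: coord_J)
    qed
    then have "f (\<Sum>j\<in>J. e j) = a J * (\<Prod>i\<in>J. coord i (\<Sum>j\<in>J. e j))"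
      unfolding f_def using J by (simp add: sum.remove[of ?I J])
    then show False using J f_sum[of J] by (simp add: coord_J)
  qed
  ultimately show ?thesis by blast
qed

end

text \<open>Symmetry carries the rounded-up half to \<open>n div 2\<close>, where binomial
  coefficients are maximal.\<close>

lemma binomial_le_ceiling_half: "n choose k \<le> n choose nat \<lceil>real n / 2\<rceil>"
proof -
  have "nat \<lceil>real n / 2\<rceil> = n - n div 2" by linarith
  then have "n choose nat \<lceil>real n / 2\<rceil> = n choose (n div 2)"
    using binomial_symmetric[of "n div 2" n] by simp
  then show ?thesis using binomial_maximum[of n k] by simp
qed

theorem theorem3p6:
  fixes n N :: nat
    and S :: "'a::comm_ring_1 set"
    and e :: "'n::finite \<Rightarrow> 'a ^ 'n"
  assumes "CARD('n) = n" and "n \<ge> 3"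
    and "finite S" and "card S = n"
    and "\<And>h. 1 \<le> h \<Longrightarrow> h \<le> n \<Longrightarrow> weak_mult_B_set h S"
    and "\<And>h J J'. 1 < h \<Longrightarrow> h < n \<Longrightarrow> J \<subseteq> S \<Longrightarrow> card J = h \<Longrightarrow> J' \<subseteq> S \<Longrightarrow> card J' = h
           \<Longrightarrow> J \<noteq> J' \<Longrightarrow> non_zerodivisor ((\<Prod>s\<in>J. s) - (\<Prod>s'\<in>J'. s'))"
    and "is_basis e"
    and "N = n choose nat \<lceil>real n / 2\<rceil>"
  shows
    "(\<exists>v :: nat \<Rightarrow> 'a ^ 'n. \<forall>f :: 'a ^ 'n \<Rightarrow> 'a.
        (\<forall>m\<^sub>0 i. affine_linear_line m\<^sub>0 (e i) f) \<longrightarrow>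
        (\<forall>j\<in>{1..N}. affine_linear_line 0 (v j) f) \<longrightarrow>
        affine_linear_on (*s) 0 UNIV f) \<and>
     (\<forall>N' < N. \<forall>v :: nat \<Rightarrow> 'a ^ 'n. \<exists>f :: 'a ^ 'n \<Rightarrow> 'a.
        \<not> affine_linear_on (*s) 0 UNIV f \<and>
        (\<forall>m\<^sub>0 i. affine_linear_line m\<^sub>0 (e i) f) \<and>
        (\<forall>j\<in>{1..N'}. affine_linear_line 0 (v j) f))"
proof (rule conjI)
  show "\<exists>v :: nat \<Rightarrow> 'a ^ 'n. \<forall>f :: 'a ^ 'n \<Rightarrow> 'a.
        (\<forall>m\<^sub>0 i. affine_linear_line m\<^sub>0 (e i) f) \<longrightarrow>
        (\<forall>j\<in>{1..N}. affine_linear_line 0 (v j) f) \<longrightarrow>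
        affine_linear_on (*s) 0 UNIV f"
    using assms(1-4) assms(6)
    by (intro sufficient_directions[OF assms(7), of S])
      (auto simp: assms(8) binomial_le_ceiling_half)
  \<comment> \<open>The counterexample lives in this degree, which must be at least 2 since degree 1
    would be affine-linear.\<close>
  have "nat \<lceil>real n / 2\<rceil> \<ge> 2" using \<open>n \<ge> 3\<close> by linarith
  then show "\<forall>N' < N. \<forall>v :: nat \<Rightarrow> 'a ^ 'n. \<exists>f :: 'a ^ 'n \<Rightarrow> 'a.
        \<not> affine_linear_on (*s) 0 UNIV f \<and>
        (\<forall>m\<^sub>0 i. affine_linear_line m\<^sub>0 (e i) f) \<and>
        (\<forall>j\<in>{1..N'}. affine_linear_line 0 (v j) f)"
    using insufficient_directions[OF assms(7)] assms(1,8) by blast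
qed

end
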